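(* Let $r\colon\mathbb{N}\to\mathbb{R}_0^+$ be a non-decreasing function. If all outerplanar graphs are fractionally $\mathrm{td}$-fragile at rate $r$, then $r(a)=\Omega(a\log a)$ (as $a\to\infty$).
   Context: All graphs are finite. The treedepth $\mathrm{td}(G)$ of a graph $G$ is the minimum integer $d$ for which there exists a rooted forest $T$ of depth at most $d-1$ (each vertex is at distance at most $d-1$ from the root of its tree) with vertex set $V(G)$ such that every edge of $G$ joins a vertex to one of its ancestors or descendants in $T$; the empty graph has treedepth $0$. For $\varepsilon>0$, a probability distribution on subsets of $V(G)$ is $\varepsilon$-thin if for each vertex $v$, the probability that $v$ belongs to a set sampled from the distribution is at most $\varepsilon$. For a graph parameter $f$ and a non-decreasing function $r\colon\mathbb{N}\to\mathbb{R}_0^+$, a graph $G$ is fractionally $f$-fragile at rate $r$ if for every positive integer $a$ there exists a $(1/a)$-thin probability distribution on the collection of sets $Y\subseteq V(G)$ satisfying $f(G-Y)\le r(a)$. *)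

theory Defs
  imports
    "HOL-Analysis.Analysis"
    "HOL-Probability.Probability"
    "HOL-Library.Landau_Symbols"
begin

record 'a graph =
  verts :: "'a set"
  edges :: "'a set set"

definition fin_graph :: "'a graph \<Rightarrow> bool" where
  "fin_graph G \<longleftrightarrow>
     finite (verts G) \<and> (\<forall>e\<in>edges G. e \<subseteq> verts G \<and> card e = 2)"

definition del_verts :: "'a graph \<Rightarrow> 'a set \<Rightarrow> 'a graph" where
  "del_verts G Y =
     \<lparr>verts = verts G - Y, edges = {e \<in> edges G. e \<inter> Y = {}}\<rparr>"

(* A rooted forest is given by its parent relation: (u, v) is in P iff v is the parent of u.
   The roots are the vertices outside Domain P, and (u, v) is in P\<^sup>+ iff v is a proper
   ancestor of u. *)

definition rooted_forest :: "'a set \<Rightarrow> ('a \<times> 'a) set \<Rightarrow> bool" where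
  "rooted_forest V P \<longleftrightarrow> P \<subseteq> V \<times> V \<and> single_valued P \<and> acyclic P"

(* Depths are compared as integers, so that depth at most 0 - 1 is possible only for the
   forest with no vertices. *)
definition forest_depth_at_most :: "'a set \<Rightarrow> ('a \<times> 'a) set \<Rightarrow> int \<Rightarrow> bool" where
  "forest_depth_at_most V P m \<longleftrightarrow>
     (\<forall>v\<in>V. \<exists>w\<in>V. w \<notin> Domain P \<and> (\<exists>k. int k \<le> m \<and> (v, w) \<in> P ^^ k))"

definition treedepth :: "'a graph \<Rightarrow> nat" where
  "treedepth G =
     (LEAST d. \<exists>P. rooted_forest (verts G) P \<and>
        forest_depth_at_most (verts G) P (int d - 1) \<and>
        (\<forall>u v. {u, v} \<in> edges G \<longrightarrow> (u, v) \<in> P\<^sup>+ \<or> (v, u) \<in> P\<^sup>+))"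

definition thin :: "real \<Rightarrow> 'a set \<Rightarrow> 'a set pmf \<Rightarrow> bool" where
  "thin \<epsilon> V p \<longleftrightarrow> (\<forall>v\<in>V. measure_pmf.prob p {Y. v \<in> Y} \<le> \<epsilon>)"

definition fractionally_fragile ::
    "('a graph \<Rightarrow> real) \<Rightarrow> (nat \<Rightarrow> real) \<Rightarrow> 'a graph \<Rightarrow> bool" where
  "fractionally_fragile f r G \<longleftrightarrow>
     (\<forall>a::nat. a \<ge> 1 \<longrightarrow>
        (\<exists>p. set_pmf p \<subseteq> {Y. Y \<subseteq> verts G \<and> f (del_verts G Y) \<le> r a} \<and>
             thin (1 / real a) (verts G) p))"

(* A drawing without crossings: pos places the vertices, and curve e is the arc drawn for
   the edge e. *)
definition plane_drawing ::
    "'a graph \<Rightarrow> ('a \<Rightarrow> complex) \<Rightarrow> ('a set \<Rightarrow> real \<Rightarrow> complex) \<Rightarrow> bool" where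
  "plane_drawing G pos curve \<longleftrightarrow>
     inj_on pos (verts G) \<and>
     (\<forall>e\<in>edges G. arc (curve e) \<and>
        {pathstart (curve e), pathfinish (curve e)} = pos ` e \<and>
        path_image (curve e) \<inter> pos ` verts G = pos ` e) \<and>
     (\<forall>e\<in>edges G. \<forall>e'\<in>edges G. e \<noteq> e' \<longrightarrow>
        path_image (curve e) \<inter> path_image (curve e') = pos ` (e \<inter> e'))"

definition drawing_image ::
    "'a graph \<Rightarrow> ('a \<Rightarrow> complex) \<Rightarrow> ('a set \<Rightarrow> real \<Rightarrow> complex) \<Rightarrow> complex set" where
  "drawing_image G pos curve = pos ` verts G \<union> (\<Union>e\<in>edges G. path_image (curve e))"

(* The outer face of a drawing is the unbounded component of its complement. The library's
   outside is the union of the unbounded components, of which there is exactly one here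
   because the drawing of a finite graph is compact. *)
definition outerplanar :: "'a graph \<Rightarrow> bool" where
  "outerplanar G \<longleftrightarrow>
     fin_graph G \<and>
     (\<exists>pos curve. plane_drawing G pos curve \<and>
        pos ` verts G \<subseteq> frontier (outside (drawing_image G pos curve)))"

end

(* Consider the recursive fans: the root is joined to all vertices of a path on N vertices, each of
   which is the root of a recursive fan of height one less, and the height is N. Drawn with
   its vertices in preorder on the real line and its edges as non-crossing arcs in the upper half
   plane, such a graph is outerplanar.

   For a = 8 N, a (1/a)-thin random set Y meets a random root-to-leaf path in about 1/8 vertices on
   average, so some Y in the support meets it in few vertices on average. For this Y, the levels of
   the fan contribute to the treedepth one by one. When all children of a vertex survive, they form
   a path, and a path on N vertices with graphs of treedepth t_1, ..., t_N attached to them has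
   treedepth at least log_4 (sum of 4^(t_j)) - 1/2, which by Jensen's inequality is at least the
   average of the t_j plus log_4 N - 1/2. Losses from deleted children are charged to the expected
   number of hits, and half of the N levels remain, giving treedepth of order N log N. *)

theory Submission imports Defs begin

section \<open>Treedepth by vertex elimination\<close>

text \<open>Walks stay inside \<open>C\<close>, so one fixed edge set \<open>E\<close> serves every
  vertex subset, and deletions only shrink the subset. The empty set counts as connected, which is
  why \<open>elim_le\<close> excludes it explicitly.\<close>

definition conn :: "'a set set \<Rightarrow> 'a set \<Rightarrow> bool" where
  "conn E C \<longleftrightarrow> (\<forall>x\<in>C. \<forall>y\<in>C. (x, y) \<in> {(u, v). u \<in> C \<and> v \<in> C \<and> {u, v} \<in> E}\<^sup>*)"

text \<open>The treedepth of the subgraph induced on \<open>S\<close> is at most \<open>d\<close>, in the form of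
  an elimination game. Quantifying over all connected subsets instead of the components makes
  monotonicity in \<open>S\<close> immediate.\<close>

primrec elim_le :: "'a set set \<Rightarrow> nat \<Rightarrow> 'a set \<Rightarrow> bool" where
  "elim_le E 0 S \<longleftrightarrow> S = {}"
| "elim_le E (Suc d) S \<longleftrightarrow>
     (\<forall>C. C \<subseteq> S \<and> C \<noteq> {} \<and> conn E C \<longrightarrow> (\<exists>x\<in>C. elim_le E d (C - {x})))"

lemma elim_le_subset: "elim_le E d S \<Longrightarrow> T \<subseteq> S \<Longrightarrow> elim_le E d T"
  by (cases d) auto

lemma conn_singleton: "conn E {x}"
  by (simp add: conn_def)

lemma conn_Un:
  assumes C: "conn E C" and D: "conn E D" and "x \<in> C" "y \<in> D" "{x, y} \<in> E"
  shows "conn E (C \<union> D)"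
proof -
  let ?R = "\<lambda>C. {(u, v). u \<in> C \<and> v \<in> C \<and> {u, v} \<in> E}"
  have sym: "sym ((?R (C \<union> D))\<^sup>*)"
    by (rule sym_rtrancl) (auto simp: sym_def insert_commute)
  have reach: "(u, x) \<in> (?R (C \<union> D))\<^sup>*" if "u \<in> C \<union> D" for u
  proof (cases "u \<in> C")
    case True
    then have "(u, x) \<in> (?R C)\<^sup>*"
      using C \<open>x \<in> C\<close> by (auto simp: conn_def)
    then show ?thesis
      by (rule rtrancl_mono[THEN subsetD, rotated]) auto
  next
    case False
    then have "(u, y) \<in> (?R D)\<^sup>*"
      using D \<open>y \<in> D\<close> that by (auto simp: conn_def)
    then have "(u, y) \<in> (?R (C \<union> D))\<^sup>*"
      by (rule rtrancl_mono[THEN subsetD, rotated]) auto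
    moreover have "(y, x) \<in> ?R (C \<union> D)"
      using assms(3-5) by (auto simp: insert_commute)
    ultimately show ?thesis
      by (rule rtrancl_into_rtrancl)
  qed
  show ?thesis
    unfolding conn_def
    using reach sym by (meson rtrancl_trans symD)
qed

text \<open>\<open>(u, v) \<in> R\<close> is read as: \<open>v\<close> is a proper ancestor of \<open>u\<close>.\<close>

lemma conn_top:
  assumes "finite C" "C \<noteq> {}" "conn E C" "trans R" "irrefl R"
    and chain: "\<And>u v w. (u, v) \<in> R \<Longrightarrow> (u, w) \<in> R \<Longrightarrow> v = w \<or> (v, w) \<in> R \<or> (w, v) \<in> R"
    and comp: "\<And>u v. u \<in> C \<Longrightarrow> v \<in> C \<Longrightarrow> {u, v} \<in> E \<Longrightarrow> (u, v) \<in> R \<or> (v, u) \<in> R"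
  shows "\<exists>x\<in>C. \<forall>v\<in>C. v = x \<or> (v, x) \<in> R"
proof -
  have "\<exists>x\<in>C. \<forall>y\<in>C. (x, y) \<notin> R"
  proof -
    have "acyclic (R \<inter> C \<times> C)"
      using assms(4,5) trancl_mono[of _ "R \<inter> C \<times> C" R]
      by (auto simp: acyclic_def irrefl_def)
    then have "wf ((R \<inter> C \<times> C)\<inverse>)"
      using \<open>finite C\<close> by (intro finite_acyclic_wf_converse) auto
    then show ?thesis
      using \<open>C \<noteq> {}\<close> unfolding wf_eq_minimal by (metis IntI SigmaI converseI ex_in_conv)
  qed
  then obtain x where x: "x \<in> C" "\<And>y. y \<in> C \<Longrightarrow> (x, y) \<notin> R"
    by blast
  \<comment> \<open>The walk from \<open>x\<close> stays below \<open>x\<close>: if its next vertex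
    \<open>w\<close> is an ancestor of \<open>u\<close>, then \<open>w\<close> and \<open>x\<close>
    are comparable, and \<open>x\<close> has no proper ancestor in \<open>C\<close>.\<close>
  have "v = x \<or> (v, x) \<in> R" if "v \<in> C" for v
  proof -
    have "(x, v) \<in> {(u, v). u \<in> C \<and> v \<in> C \<and> {u, v} \<in> E}\<^sup>*"
      using assms(3) x that by (auto simp: conn_def)
    then show ?thesis
    proof (induction rule: rtrancl_induct)
      case (step u w)
      then have "u \<in> C" "w \<in> C" "(u, w) \<in> R \<or> (w, u) \<in> R"
        using comp by auto
      with step.IH x chain \<open>trans R\<close> show ?case
        by (meson transE)
    qed simp
  qed
  then show ?thesis
    using x by blast
qed

text \<open>The top vertex of a connected \<open>C\<close> is a proper ancestor of all its other
  vertices, so eliminating it shortens every ancestor chain inside \<open>C\<close> by one.\<close>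

lemma elim_le_of_chains:
  assumes "finite S" "trans R" "irrefl R"
    and chain: "\<And>u v w. (u, v) \<in> R \<Longrightarrow> (u, w) \<in> R \<Longrightarrow> v = w \<or> (v, w) \<in> R \<or> (w, v) \<in> R"
    and "\<And>u v. u \<in> S \<Longrightarrow> v \<in> S \<Longrightarrow> {u, v} \<in> E \<Longrightarrow> (u, v) \<in> R \<or> (v, u) \<in> R"
    and "\<And>v. v \<in> S \<Longrightarrow> card {w \<in> S. w = v \<or> (v, w) \<in> R} \<le> d"
  shows "elim_le E d S"
  using assms(1,5,6)
proof (induction d arbitrary: S)
  case 0
  have False if "v \<in> S" for v
  proof -
    have "card {w \<in> S. w = v \<or> (v, w) \<in> R} = 0" using 0(3)[OF that] by simp
    then show False using \<open>finite S\<close> that by auto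
  qed
  then show ?case by auto
next
  case (Suc d)
  have "\<exists>x\<in>C. elim_le E d (C - {x})" if C: "C \<subseteq> S" "C \<noteq> {}" "conn E C" for C
  proof -
    have "finite C" using C Suc.prems(1) finite_subset by blast
    have comp: "(u, v) \<in> R \<or> (v, u) \<in> R" if "u \<in> C" "v \<in> C" "{u, v} \<in> E" for u v
      using Suc.prems(2) C(1) that by blast
    have "\<exists>x\<in>C. \<forall>v\<in>C. v = x \<or> (v, x) \<in> R"
      by (rule conn_top[OF \<open>finite C\<close> C(2,3) assms(2,3)]) (fact chain, fact comp)
    then obtain x where x: "x \<in> C" "\<And>v. v \<in> C \<Longrightarrow> v \<noteq> x \<Longrightarrow> (v, x) \<in> R"
      by blast
    have "elim_le E d (C - {x})"
    proof (rule Suc.IH)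
      fix v assume v: "v \<in> C - {x}"
      have "card (insert x {w \<in> C - {x}. w = v \<or> (v, w) \<in> R})
          \<le> card {w \<in> S. w = v \<or> (v, w) \<in> R}"
        using v x C(1) Suc.prems(1) by (intro card_mono) auto
      also have "\<dots> \<le> Suc d"
        using v C(1) Suc.prems(3) by blast
      finally show "card {w \<in> C - {x}. w = v \<or> (v, w) \<in> R} \<le> d"
        using \<open>finite C\<close> by simp
    qed (use \<open>finite C\<close> Suc.prems(2) C(1) in auto)
    then show ?thesis using x by blast
  qed
  then show ?case by simp
qed

section \<open>Rooted forests as elimination strategies\<close>

lemma single_valued_rtrancl_linear:
  assumes "single_valued P" "(u, v) \<in> P\<^sup>*" "(u, w) \<in> P\<^sup>*"
  shows "(v, w) \<in> P\<^sup>* \<or> (w, v) \<in> P\<^sup>*"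
  using assms(2)
proof (induction rule: rtrancl_induct)
  case (step y z)
  show ?case
  proof (cases "(y, w) \<in> P\<^sup>*")
    case True
    then show ?thesis
      using step.hyps(2) assms(1) by (metis converse_rtranclE r_into_rtrancl single_valuedD)
  next
    case False
    then show ?thesis
      using step by (meson rtrancl_into_rtrancl)
  qed
qed (use assms(3) in simp)

text \<open>Finiteness is part of the claim because the count is later compared by monotonicity of
  \<open>card\<close>, which is 0 on infinite sets.\<close>

lemma card_ancestors_le:
  assumes "single_valued P" "(v, w) \<in> P ^^ k" "w \<notin> Domain P"
  shows "finite {x. (v, x) \<in> P\<^sup>*} \<and> card {x. (v, x) \<in> P\<^sup>*} \<le> Suc k"
  using assms(2)
proof (induction k arbitrary: v)
  case 0
  have "{x. (v, x) \<in> P\<^sup>*} = {v}"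
    using 0 assms(3) by (auto elim: converse_rtranclE)
  then show ?case by simp
next
  case (Suc k)
  then obtain u where u: "(v, u) \<in> P" "(u, w) \<in> P ^^ k"
    by (meson relpow_Suc_E2)
  have "(v, x) \<in> P\<^sup>* \<longleftrightarrow> x = v \<or> (u, x) \<in> P\<^sup>*" for x
    using u(1) assms(1)
    by (metis converse_rtranclE converse_rtrancl_into_rtrancl rtrancl.rtrancl_refl single_valuedD)
  then have "{x. (v, x) \<in> P\<^sup>*} = insert v {x. (u, x) \<in> P\<^sup>*}"
    by blast
  then show ?case
    using Suc.IH[OF u(2)] by (auto simp: card_insert_if)
qed

lemma elim_le_of_forest:
  assumes "finite V" "rooted_forest V P" "forest_depth_at_most V P (int d - 1)"
    and edge: "\<And>u v. {u, v} \<in> E \<Longrightarrow> u \<in> V \<Longrightarrow> v \<in> V \<Longrightarrow> (u, v) \<in> P\<^sup>+ \<or> (v, u) \<in> P\<^sup>+"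
  shows "elim_le E d V"
proof (rule elim_le_of_chains[where R = "P\<^sup>+"])
  have P: "single_valued P" "acyclic P"
    using assms(2) by (auto simp: rooted_forest_def)
  show "irrefl (P\<^sup>+)"
    using P by (simp add: acyclic_irrefl)
  show "v = w \<or> (v, w) \<in> P\<^sup>+ \<or> (w, v) \<in> P\<^sup>+" if "(u, v) \<in> P\<^sup>+" "(u, w) \<in> P\<^sup>+" for u v w
    using single_valued_rtrancl_linear[OF P(1)] that
    by (metis rtranclD trancl_into_rtrancl)
  show "card {w \<in> V. w = v \<or> (v, w) \<in> P\<^sup>+} \<le> d" if v: "v \<in> V" for v
  proof -
    obtain w k where w: "w \<notin> Domain P" "int k \<le> int d - 1" "(v, w) \<in> P ^^ k"
      using assms(3) v unfolding forest_depth_at_most_def by blast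
    have "card {w \<in> V. w = v \<or> (v, w) \<in> P\<^sup>+} \<le> card {x. (v, x) \<in> P\<^sup>*}"
      using card_ancestors_le[OF P(1) w(3,1)] by (intro card_mono) auto
    also have "\<dots> \<le> Suc k"
      using card_ancestors_le[OF P(1) w(3,1)] by simp
    \<comment> \<open>Depth counts parent steps while the chain counts vertices: at most
      \<open>d - 1\<close> steps give at most \<open>d\<close> vertices.\<close>
    finally show ?thesis using w(2) by linarith
  qed
  show "trans (P\<^sup>+)"
    by (rule trans_trancl)
  show "(u, v) \<in> P\<^sup>+ \<or> (v, u) \<in> P\<^sup>+" if "u \<in> V" "v \<in> V" "{u, v} \<in> E" for u v
    using edge that by blast
qed fact

text \<open>This makes the \<open>LEAST\<close> in \<open>treedepth\<close> attained: in a single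
  descending chain all vertices are comparable, whatever the edges are.\<close>

lemma path_forest_exists:
  assumes "finite V"
  shows "\<exists>P. rooted_forest V P \<and> forest_depth_at_most V P (int (card V) - 1) \<and>
    (\<forall>u\<in>V. \<forall>v\<in>V. u \<noteq> v \<longrightarrow> (u, v) \<in> P\<^sup>+ \<or> (v, u) \<in> P\<^sup>+)"
proof -
  obtain f where f: "bij_betw f {0..<card V} V"
    using assms ex_bij_betw_nat_finite by blast
  define P where "P = (\<lambda>i. (f (Suc i), f i)) ` {i. Suc i < card V}"
  have inj: "i = j" if "f i = f j" "i < card V" "j < card V" for i j
    using f that by (auto simp: bij_betw_def inj_on_def)
  have mem: "f i \<in> V" if "i < card V" for i
    using f that by (auto simp: bij_betw_def)
  have surj: "\<exists>i<card V. u = f i" if "u \<in> V" for u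
    using f that by (force simp: bij_betw_def)
  have pow: "(f (i + k), f i) \<in> P ^^ k" if "i + k < card V" for i k
    using that
  proof (induction k)
    case (Suc k)
    have "(f (Suc (i + k)), f (i + k)) \<in> P"
      using Suc.prems by (auto simp: P_def)
    moreover have "(f (i + k), f i) \<in> P ^^ k"
      using Suc by simp
    ultimately show ?case
      by (metis add_Suc_right relpow_Suc_I2)
  qed simp
  have trancl: "\<exists>i j. u = f i \<and> v = f j \<and> j < i \<and> i < card V" if "(u, v) \<in> P\<^sup>+" for u v
    using that
  proof (induction rule: trancl_induct)
    case (base y)
    then show ?case by (auto simp: P_def)
  next
    case (step y z)
    then obtain i j k where "u = f i" "y = f j" "j < i" "i < card V"
      "y = f (Suc k)" "z = f k" "Suc k < card V"
      by (auto simp: P_def)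
    then show ?case
      using inj[of j "Suc k"] by (metis Suc_lessD less_trans)
  qed
  have "single_valued P"
    by (auto simp: single_valued_def P_def dest: inj)
  moreover have "acyclic P"
    unfolding acyclic_def using trancl inj by fastforce
  moreover have "P \<subseteq> V \<times> V"
    using mem by (auto simp: P_def)
  moreover have "forest_depth_at_most V P (int (card V) - 1)"
    unfolding forest_depth_at_most_def
  proof
    fix v assume "v \<in> V"
    then obtain i where i: "i < card V" "v = f i" using surj by blast
    have "f 0 \<notin> Domain P"
      using inj by (fastforce simp: P_def)
    moreover have "f 0 \<in> V" using i mem by simp
    moreover have "(v, f 0) \<in> P ^^ i" using pow[of 0 i] i by simp
    ultimately show "\<exists>w\<in>V. w \<notin> Domain P \<and> (\<exists>k. int k \<le> int (card V) - 1 \<and> (v, w) \<in> P ^^ k)"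
      using i by (intro bexI[of _ "f 0"] conjI exI[of _ i]) auto
  qed
  moreover have "(u, v) \<in> P\<^sup>+ \<or> (v, u) \<in> P\<^sup>+" if uv: "u \<in> V" "v \<in> V" "u \<noteq> v" for u v
  proof -
    have below: "(f i, f j) \<in> P\<^sup>+" if "j < i" "i < card V" for i j
    proof -
      have "(f i, f j) \<in> P ^^ (i - j)"
        using pow[of j "i - j"] that by simp
      then show ?thesis
        using that by (metis trancl_power zero_less_diff)
    qed
    obtain i j where "u = f i" "v = f j" "i < card V" "j < card V" using surj uv by metis
    then show ?thesis
      using below uv(3) by (metis linorder_neqE_nat)
  qed
  ultimately show ?thesis
    unfolding rooted_forest_def by blast
qed

text \<open>\<open>E\<close> may have further edges leaving \<open>verts G\<close>, so the edge set
  of the original graph can be kept after vertices are deleted.\<close>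

lemma elim_le_treedepth:
  assumes "finite (verts G)" "\<And>e. e \<in> edges G \<Longrightarrow> e \<subseteq> verts G \<and> card e = 2"
    and "\<And>u v. u \<in> verts G \<Longrightarrow> v \<in> verts G \<Longrightarrow> {u, v} \<in> E \<Longrightarrow> {u, v} \<in> edges G"
  shows "elim_le E (treedepth G) (verts G)"
proof -
  let ?Q = "\<lambda>d. \<exists>P. rooted_forest (verts G) P \<and>
        forest_depth_at_most (verts G) P (int d - 1) \<and>
        (\<forall>u v. {u, v} \<in> edges G \<longrightarrow> (u, v) \<in> P\<^sup>+ \<or> (v, u) \<in> P\<^sup>+)"
  have ne: "u \<in> verts G \<and> v \<in> verts G \<and> u \<noteq> v" if "{u, v} \<in> edges G" for u v
    using assms(2)[OF that] by (auto simp: card_2_iff doubleton_eq_iff)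
  have "?Q (card (verts G))"
    using path_forest_exists[OF assms(1)] ne by blast
  then have "?Q (treedepth G)"
    unfolding treedepth_def by (rule LeastI)
  then show ?thesis
    using elim_le_of_forest[OF assms(1)] assms(3) by blast
qed

section \<open>Arc diagrams are outerplanar drawings\<close>

text \<open>The arc of y = (x - a)(b - x) above [a, b]: the semicircle on this diameter with its
  heights squared, so that only polynomials occur.\<close>

definition parabola :: "real \<Rightarrow> real \<Rightarrow> real \<Rightarrow> complex" where
  "parabola a b t = Complex (a + t * (b - a)) ((t * (b - a)) * ((1 - t) * (b - a)))"

lemma path_image_parabola:
  assumes "a < b"
  shows "path_image (parabola a b) = {Complex x ((x - a) * (b - x)) |x. a \<le> x \<and> x \<le> b}"
proof (intro equalityI subsetI)
  fix z assume "z \<in> path_image (parabola a b)"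
  then obtain t where t: "0 \<le> t" "t \<le> 1" "z = parabola a b t"
    by (auto simp: path_image_def)
  have "0 \<le> t * (b - a)" "t * (b - a) \<le> b - a"
    using t assms by (auto simp: mult_left_le_one_le)
  then have "a \<le> a + t * (b - a)" "a + t * (b - a) \<le> b"
    by auto
  moreover have "z = Complex (a + t * (b - a)) ((a + t * (b - a) - a) * (b - (a + t * (b - a))))"
    using t(3) by (simp add: parabola_def left_diff_distrib)
  ultimately show "z \<in> {Complex x ((x - a) * (b - x)) |x. a \<le> x \<and> x \<le> b}"
    by blast
next
  fix z assume "z \<in> {Complex x ((x - a) * (b - x)) |x. a \<le> x \<and> x \<le> b}"
  then obtain x where x: "a \<le> x" "x \<le> b" "z = Complex x ((x - a) * (b - x))"
    by blast
  have "(1 - (x - a) / (b - a)) * (b - a) = b - x"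
    using assms by (simp add: field_simps)
  then have "z = parabola a b ((x - a) / (b - a))"
    using x assms by (simp add: parabola_def)
  moreover have "(x - a) / (b - a) \<in> {0..1}"
    using x assms by (simp add: divide_le_eq_1)
  ultimately show "z \<in> path_image (parabola a b)"
    unfolding path_image_def by blast
qed

lemma arc_parabola:
  assumes "a < b"
  shows "arc (parabola a b)"
proof -
  have "parabola a b = (\<lambda>t. of_real (a + t * (b - a)) +
      \<i> * of_real ((t * (b - a)) * ((1 - t) * (b - a))))"
    by (auto simp: parabola_def complex_eq_iff)
  then have "path (parabola a b)"
    unfolding path_def by (simp only:) (intro continuous_intros)
  moreover have "inj_on (parabola a b) {0..1}"
    using assms by (auto simp: inj_on_def parabola_def)
  ultimately show ?thesis
    by (simp add: arc_def)
qed

lemma parabola_inter_reals: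
  assumes "a < b"
  shows "path_image (parabola a b) \<inter> \<real> = {of_real a, of_real b}"
  using assms unfolding path_image_parabola[OF assms]
  by (auto simp: complex_is_Real_iff complex_eq_iff)

text \<open>At a common abscissa both factors of the outer height are at least those of the inner
  height and one is larger, so the arcs differ wherever the inner one is off the real axis.\<close>

lemma parabola_Int_nested:
  assumes "a < b" "c < d" "a \<le> c" "d \<le> b" "a < c \<or> d < b"
  shows "path_image (parabola a b) \<inter> path_image (parabola c d) \<subseteq> \<real>"
proof
  fix z assume "z \<in> path_image (parabola a b) \<inter> path_image (parabola c d)"
  then obtain x where x: "a \<le> x" "x \<le> b" "c \<le> x" "x \<le> d"
    "z = Complex x ((x - a) * (b - x))" "(x - a) * (b - x) = (x - c) * (d - x)"
    using assms by (auto simp: path_image_parabola)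
  have "(x - c) * (d - x) = 0"
  proof (rule ccontr)
    assume "(x - c) * (d - x) \<noteq> 0"
    then have "c < x" "x < d" using x by auto
    have "(x - c) * (d - x) < (x - a) * (b - x)"
      using assms(5)
    proof
      assume "a < c"
      have "(x - c) * (d - x) \<le> (x - c) * (b - x)"
        using assms x by (intro mult_left_mono) auto
      also have "\<dots> < (x - a) * (b - x)"
        using \<open>a < c\<close> \<open>x < d\<close> assms by (intro mult_strict_right_mono) auto
      finally show ?thesis .
    next
      assume "d < b"
      have "(x - c) * (d - x) < (x - c) * (b - x)"
        using \<open>d < b\<close> \<open>c < x\<close> by (intro mult_strict_left_mono) auto
      also have "\<dots> \<le> (x - a) * (b - x)"
        using assms x by (intro mult_right_mono) auto
      finally show ?thesis .
    qed
    then show False using x by simp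
  qed
  then show "z \<in> \<real>"
    using x by (simp add: complex_is_Real_iff)
qed

lemma parabola_Int_apart:
  assumes "a < b" "c < d" "b \<le> c"
  shows "path_image (parabola a b) \<inter> path_image (parabola c d) \<subseteq> \<real>"
  using assms by (auto simp: path_image_parabola complex_is_Real_iff)

text \<open>Only the order in which \<open>e\<close> starts first is covered, so noncrossing has to
  be required both ways. The inequalities are strict: sharing an endpoint is no crossing.\<close>

definition crossing :: "nat \<times> nat \<Rightarrow> nat \<times> nat \<Rightarrow> bool" where
  "crossing e e' \<longleftrightarrow> fst e < fst e' \<and> fst e' < snd e \<and> snd e < snd e'"

text \<open>Distinct noncrossing intervals are apart or properly nested, so their arcs meet only on
  the real axis, which each arc touches just at its two endpoints.\<close>

lemma parabola_Int:
  fixes a b c d :: nat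
  assumes "a < b" "c < d" "(a, b) \<noteq> (c, d)"
    and "\<not> crossing (a, b) (c, d)" "\<not> crossing (c, d) (a, b)"
  shows "path_image (parabola a b) \<inter> path_image (parabola c d) = of_nat ` ({a, b} \<inter> {c, d})"
proof -
  have "b \<le> c \<or> d \<le> a \<or> a \<le> c \<and> d \<le> b \<and> (a < c \<or> d < b) \<or> c \<le> a \<and> b \<le> d \<and> (c < a \<or> b < d)"
    using assms by (auto simp: crossing_def)
  then have real: "path_image (parabola a b) \<inter> path_image (parabola c d) \<subseteq> \<real>"
  proof (elim disjE)
    assume "b \<le> c" then show ?thesis using parabola_Int_apart[of a b c d] assms by simp
  next
    assume "d \<le> a" then show ?thesis using parabola_Int_apart[of c d a b] assms by (simp add: Int_commute)
  next
    assume "a \<le> c \<and> d \<le> b \<and> (a < c \<or> d < b)"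
    then show ?thesis using parabola_Int_nested[of a b c d] assms by simp
  next
    assume "c \<le> a \<and> b \<le> d \<and> (c < a \<or> b < d)"
    then show ?thesis using parabola_Int_nested[of c d a b] assms by (simp add: Int_commute)
  qed
  then have "path_image (parabola a b) \<inter> path_image (parabola c d) =
      (path_image (parabola a b) \<inter> \<real>) \<inter> (path_image (parabola c d) \<inter> \<real>)"
    by blast
  also have "\<dots> = of_nat ` ({a, b} \<inter> {c, d})"
    using assms by (subst (1 2) parabola_inter_reals) auto
  finally show ?thesis .
qed

text \<open>With vertices on the real line and arcs above it, the open lower half plane lies in the
  outer face and has every vertex in its closure.\<close>

lemma outerplanar_noncrossing:
  fixes F :: "(nat \<times> nat) set"
  assumes F: "\<And>x y. (x, y) \<in> F \<Longrightarrow> x < y \<and> y < s"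
    and nc: "\<And>e e'. e \<in> F \<Longrightarrow> e' \<in> F \<Longrightarrow> \<not> crossing e e'"
  shows "outerplanar \<lparr>verts = {..<s}, edges = (\<lambda>(x, y). {x, y}) ` F\<rparr>"
proof -
  define G :: "nat graph" where "G = \<lparr>verts = {..<s}, edges = (\<lambda>(x, y). {x, y}) ` F\<rparr>"
  \<comment> \<open>Edges are unordered here; \<open>Min\<close> and \<open>Max\<close> recover the
    left and right ends.\<close>
  define curve where "curve e = parabola (Min e) (Max e)" for e :: "nat set"
  define pos :: "nat \<Rightarrow> complex" where "pos = of_nat"
  have E: "\<exists>x y. (x, y) \<in> F \<and> e = {x, y} \<and> x < y \<and> y < s \<and> curve e = parabola x y"
    if "e \<in> edges G" for e
  proof -
    have "\<exists>p\<in>F. e = (\<lambda>(x, y). {x, y}) p"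
      using that by (simp add: G_def image_iff)
    then obtain x y where "(x, y) \<in> F" "e = {x, y}"
      by (metis case_prod_conv surj_pair)
    then show ?thesis
      using F[of x y] by (intro exI[of _ x] exI[of _ y]) (auto simp: curve_def)
  qed
  have fin: "fin_graph G"
    unfolding fin_graph_def
  proof
    show "finite (verts G)" by (simp add: G_def)
    show "\<forall>e\<in>edges G. e \<subseteq> verts G \<and> card e = 2"
    proof
      fix e assume "e \<in> edges G"
      then obtain x y where "e = {x, y}" "x < y" "y < s" using E by blast
      then show "e \<subseteq> verts G \<and> card e = 2" by (simp add: G_def)
    qed
  qed
  have pos: "pos ` A \<subseteq> \<real>" for A
    by (auto simp: pos_def)
  have plane: "plane_drawing G pos curve"
    unfolding plane_drawing_def
  proof (intro conjI ballI impI)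
    show "inj_on pos (verts G)"
      by (simp add: pos_def inj_on_def)
  next
    fix e assume "e \<in> edges G"
    then obtain x y where e: "e = {x, y}" "x < y" "y < s" "curve e = parabola x y"
      using E by blast
    show "arc (curve e)"
      using e by (simp add: arc_parabola)
    show "{pathstart (curve e), pathfinish (curve e)} = pos ` e"
      using e by (auto simp: pathstart_def pathfinish_def parabola_def pos_def complex_eq_iff)
    have "path_image (curve e) \<inter> pos ` verts G = (path_image (curve e) \<inter> \<real>) \<inter> pos ` verts G"
      using pos by blast
    also have "path_image (curve e) \<inter> \<real> = pos ` e"
      unfolding e(4) using e(1,2) by (subst parabola_inter_reals) (auto simp: pos_def)
    also have "pos ` e \<inter> pos ` verts G = pos ` e"
      using e by (auto simp: G_def)
    finally show "path_image (curve e) \<inter> pos ` verts G = pos ` e" .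
  next
    fix e e' assume "e \<in> edges G" "e' \<in> edges G" "e \<noteq> e'"
    obtain x y where e: "(x, y) \<in> F" "e = {x, y}" "x < y" "curve e = parabola x y"
      using E[OF \<open>e \<in> edges G\<close>] by blast
    obtain x' y' where e': "(x', y') \<in> F" "e' = {x', y'}" "x' < y'" "curve e' = parabola x' y'"
      using E[OF \<open>e' \<in> edges G\<close>] by blast
    show "path_image (curve e) \<inter> path_image (curve e') = pos ` (e \<inter> e')"
      unfolding e(4) e'(4) unfolding e(2) e'(2) pos_def
      using e e' \<open>e \<noteq> e'\<close> nc by (intro parabola_Int) auto
  qed
  define D where "D = drawing_image G pos curve"
  have upper: "Im z \<ge> 0" if "z \<in> D" for z
  proof -
    have "z \<in> pos ` verts G \<or> (\<exists>e\<in>edges G. z \<in> path_image (curve e))"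
      using that by (auto simp: D_def drawing_image_def)
    then show ?thesis
    proof (elim disjE bexE)
      fix e assume e: "e \<in> edges G" "z \<in> path_image (curve e)"
      then obtain x y where "x < y" "z \<in> path_image (parabola (real x) (real y))"
        using E by metis
      then show ?thesis by (auto simp: path_image_parabola)
    qed (auto simp: pos_def)
  qed
  \<comment> \<open>The drawing lies in the convex closed upper half plane, and the complement of a
    convex superset is in the outside.\<close>
  have "{z. Im z < 0} \<subseteq> outside D"
  proof (rule outside_subset_convex[of "{z. Im z \<ge> 0}" D, THEN subset_trans[rotated]])
    show "convex {z. Im z \<ge> 0}" by (rule convex_halfspace_Im_ge)
  qed (use upper in auto)
  then have "closure {z. Im z < 0} \<subseteq> closure (outside D)"
    by (rule closure_mono)
  then have "{z. Im z \<le> 0} \<subseteq> closure (outside D)"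
    using closure_halfspace_lt[of \<i> 0] by simp
  moreover have "pos ` verts G \<subseteq> {z. Im z \<le> 0}"
    by (auto simp: pos_def)
  moreover have "pos ` verts G \<subseteq> D"
    by (auto simp: D_def drawing_image_def)
  then have "pos ` verts G \<inter> interior (outside D) = {}"
    using outside_no_overlap[of D] interior_subset[of "outside D"] by blast
  ultimately have "pos ` verts G \<subseteq> frontier (outside D)"
    unfolding frontier_def by blast
  then show ?thesis
    using fin plane unfolding outerplanar_def D_def G_def by blast
qed

section \<open>Recursive fans\<close>

fun fan_size :: "nat \<Rightarrow> nat \<Rightarrow> nat" where
  "fan_size N 0 = 1"
| "fan_size N (Suc i) = Suc (N * fan_size N i)"

text \<open>Vertices are numbered in preorder: the subtree of height \<open>i\<close> rooted at \<open>v\<close> occupies the interval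
  \<open>{v..<v + fan_size N i}\<close>, within which the subtrees of the children are
  consecutive blocks. In \<open>child N i v j\<close>, \<open>i\<close> is the height of the children, not that of \<open>v\<close>.\<close>

definition child :: "nat \<Rightarrow> nat \<Rightarrow> nat \<Rightarrow> nat \<Rightarrow> nat" where
  "child N i v j = Suc (v + j * fan_size N i)"

text \<open>Every pair is increasing in preorder, the orientation that \<open>crossing\<close>
  presupposes.\<close>

fun fan_edges :: "nat \<Rightarrow> nat \<Rightarrow> nat \<Rightarrow> (nat \<times> nat) set" where
  "fan_edges N 0 v = {}"
| "fan_edges N (Suc i) v =
     {(v, child N i v j) |j. j < N} \<union> {(child N i v j, child N i v (Suc j)) |j. Suc j < N} \<union>
     (\<Union>j<N. fan_edges N i (child N i v j))"

lemma fan_size_pos: "fan_size N i > 0"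
  by (cases i) auto

lemma child_Suc: "child N i v (Suc j) = child N i v j + fan_size N i"
  by (simp add: child_def)

lemma child_mono: "j \<le> k \<Longrightarrow> child N i v j \<le> child N i v k"
  by (simp add: child_def)

text \<open>\<open>N\<close> is not the index of a child; at this value \<open>child\<close> yields
  the first number after the last block.\<close>

lemma child_end: "child N i v N = v + fan_size N (Suc i)"
  by (simp add: child_def)

lemma child_gt: "v < child N i v j"
  by (simp add: child_def)

lemma child_block_end:
  "j < N \<Longrightarrow> child N i v j + fan_size N i \<le> v + fan_size N (Suc i)"
  using child_mono[of "Suc j" N N i v] by (simp add: child_Suc child_end del: fan_size.simps)

lemma fan_edges_bounds:
  "(x, y) \<in> fan_edges N i v \<Longrightarrow> v \<le> x \<and> x < y \<and> y < v + fan_size N i"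
proof (induction i arbitrary: v)
  case (Suc i)
  have block: "v < child N i v j" "child N i v j + fan_size N i \<le> v + fan_size N (Suc i)" if "j < N" for j
    using child_gt child_block_end[OF that] by auto
  from Suc.prems consider j where "j < N" "x = v" "y = child N i v j"
    | j where "Suc j < N" "x = child N i v j" "y = child N i v (Suc j)"
    | j where "j < N" "(x, y) \<in> fan_edges N i (child N i v j)"
    by auto
  then show ?case
  proof cases
    case 1 then show ?thesis using block[of j] fan_size_pos[of N i] by simp
  next
    case 2 then show ?thesis using block[of "Suc j"] block[of j] fan_size_pos[of N i] child_Suc[of N i v j] by simp
  next
    case 3 then show ?thesis using Suc.IH[of "child N i v j"] block[of j] by simp
  qed
qed simp

text \<open>If \<open>e'\<close> starts inside \<open>e\<close>, it does not start at
  \<open>v\<close>, so it spans at most one block and its closing endpoint. The right end of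
  \<open>e\<close> then falls strictly inside that block, which forces both edges into the same
  child fan.\<close>

lemma fan_edges_noncrossing:
  "e \<in> fan_edges N i v \<Longrightarrow> e' \<in> fan_edges N i v \<Longrightarrow> \<not> crossing e e'"
proof (induction i arbitrary: v)
  case (Suc i)
  have cases: "(\<exists>j<N. x = v \<and> y = child N i v j) \<or>
      (\<exists>j. Suc j < N \<and> x = child N i v j \<and> y = child N i v (Suc j)) \<or>
      (\<exists>j<N. (x, y) \<in> fan_edges N i (child N i v j) \<and> child N i v j \<le> x \<and> x < y
         \<and> y < child N i v (Suc j))"
    if "(x, y) \<in> fan_edges N (Suc i) v" for x y
    using that fan_edges_bounds[of x y N i] by (fastforce simp: child_Suc)
  have ord: "child N i v j \<le> child N i v k \<or> child N i v (Suc k) \<le> child N i v j" for j k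
    using child_mono[of j k N i v] child_mono[of "Suc k" j N i v] by linarith
  obtain x y x' y' where e: "e = (x, y)" "e' = (x', y')" by fastforce
  show ?case
  proof
    assume "crossing e e'"
    then have cr: "x < x'" "x' < y" "y < y'" by (auto simp: crossing_def e)
    have "x' \<noteq> v"
      using fan_edges_bounds[of x y N "Suc i" v] Suc.prems(1) cr e by auto
    with cases[of x' y'] Suc.prems e consider
      k where "x' = child N i v k" "y' = child N i v (Suc k)"
      | k where "k < N" "(x', y') \<in> fan_edges N i (child N i v k)" "child N i v k \<le> x'" "y' < child N i v (Suc k)"
      by blast
    then obtain k where k: "child N i v k \<le> x'" "y' \<le> child N i v (Suc k)"
      "k < N \<and> (x', y') \<in> fan_edges N i (child N i v k) \<or> x' = child N i v k"
      by (metis less_imp_le order_refl)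
    from cases[of x y] Suc.prems e consider
      j where "y = child N i v j"
      | j where "j < N" "(x, y) \<in> fan_edges N i (child N i v j)" "child N i v j \<le> x" "y < child N i v (Suc j)"
      by blast
    then show False
    proof cases
      \<comment> \<open>Spokes and path edges end at a child, and none lies strictly between two
        consecutive children.\<close>
      case 1
      then show False using ord[of j k] cr k by linarith
    next
      case (2 j)
      have "j = k"
      proof (rule ccontr)
        assume "j \<noteq> k"
        then have "child N i v (Suc j) \<le> child N i v k \<or> child N i v (Suc k) \<le> child N i v j"
          using child_mono[of "Suc j" k N i v] child_mono[of "Suc k" j N i v] by linarith
        then show False using 2 k cr by linarith
      qed
      \<comment> \<open>\<open>x'\<close> exceeds \<open>x\<close> and hence the first number of the
        block, so \<open>e'\<close> cannot be a path edge starting there.\<close>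
      with k(3) have "(x', y') \<in> fan_edges N i (child N i v j)"
        using 2 cr by auto
      then show False
        using Suc.IH[of "child N i v j"] 2 \<open>crossing e e'\<close> e by blast
    qed
  qed
qed simp

section \<open>Treedepth of recursive fans after deletions\<close>

text \<open>Jensen's inequality: each term lies above the tangent of \<open>b powr t\<close> at the
  mean \<open>m\<close>, and the linear parts cancel in the sum.\<close>

lemma sum_powr_ge:
  fixes x :: "nat \<Rightarrow> real" and b :: real
  assumes "N > 0" "b > 0"
  shows "real N * b powr ((\<Sum>j<N. x j) / real N) \<le> (\<Sum>j<N. b powr x j)"
proof -
  define m where "m = (\<Sum>j<N. x j) / real N"
  have "b powr m * (1 + (x j - m) * ln b) \<le> b powr x j" for j
  proof -
    have "1 + (x j - m) * ln b \<le> b powr (x j - m)"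
      using exp_ge_add_one_self[of "(x j - m) * ln b"] assms by (simp add: powr_def)
    then have "b powr m * (1 + (x j - m) * ln b) \<le> b powr m * b powr (x j - m)"
      by (intro mult_left_mono) auto
    then show ?thesis
      by (simp flip: powr_add)
  qed
  then have "(\<Sum>j<N. b powr m * (1 + (x j - m) * ln b)) \<le> (\<Sum>j<N. b powr x j)"
    by (intro sum_mono)
  moreover have "(\<Sum>j<N. b powr m * (1 + (x j - m) * ln b)) = real N * b powr m"
  proof -
    have "(\<Sum>j<N. x j - m) = 0"
      using assms by (simp add: sum_subtractf m_def)
    then have "(\<Sum>j<N. (x j - m) * ln b) = 0"
      by (metis mult_zero_left sum_distrib_right)
    then show ?thesis
      by (simp add: sum.distrib flip: sum_distrib_left)
  qed
  ultimately show ?thesis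
    by (simp add: m_def)
qed

section \<open>Elimination of connected sets strung along a path\<close>

lemma conn_UN_path:
  assumes C: "\<And>j. j < N \<Longrightarrow> conn E (C j) \<and> p j \<in> C j"
    and path: "\<And>j. Suc j < N \<Longrightarrow> {p j, p (Suc j)} \<in> E"
    and "l < u" "u \<le> N"
  shows "conn E (\<Union>j\<in>{l..<u}. C j)"
  using \<open>l < u\<close> \<open>u \<le> N\<close>
proof (induction u)
  case (Suc u)
  show ?case
  proof (cases "l = u")
    case True
    then show ?thesis using C[of u] Suc.prems by simp
  next
    case False
    then have "l < u" using Suc.prems by simp
    then have "p (u - 1) \<in> (\<Union>j\<in>{l..<u}. C j)"
      using C[of "u - 1"] Suc.prems by (intro UN_I[of "u - 1"]) auto
    then have "conn E ((\<Union>j\<in>{l..<u}. C j) \<union> C u)"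
      using \<open>l < u\<close> Suc C[of u] path[of "u - 1"]
      by (intro conn_Un[where x = "p (u - 1)" and y = "p u"]) auto
    moreover have "(\<Union>j\<in>{l..<Suc u}. C j) = (\<Union>j\<in>{l..<u}. C j) \<union> C u"
      using \<open>l < u\<close> by (auto simp: atLeastLessThanSuc)
    ultimately show ?thesis by simp
  qed
qed simp

text \<open>The base 4 absorbs the loss in the induction: eliminating a vertex of \<open>C m\<close> leaves the parts of
  the path on both sides of \<open>m\<close>, and \<open>2 * 4 ^ d + 4 ^ Suc d + 2 * 4 ^ d = 2 * 4 ^ Suc d\<close>.\<close>

lemma sum_powr_le_of_path:
  fixes x :: "nat \<Rightarrow> real"
  assumes C: "\<And>j. j < N \<Longrightarrow> conn E (C j) \<and> p j \<in> C j"
    and path: "\<And>j. Suc j < N \<Longrightarrow> {p j, p (Suc j)} \<in> E"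
    and x: "\<And>j d. j < N \<Longrightarrow> elim_le E d (C j) \<Longrightarrow> x j \<le> real d"
    and disj: "\<And>j k. j < N \<Longrightarrow> k < N \<Longrightarrow> j \<noteq> k \<Longrightarrow> C j \<inter> C k = {}"
    and "u \<le> N" "elim_le E d (\<Union>j\<in>{l..<u}. C j)"
  shows "(\<Sum>j=l..<u. 4 powr x j) \<le> 2 * 4 ^ d"
  using assms(5,6)
proof (induction d arbitrary: l u)
  case 0
  have "\<not> l < u"
  proof
    assume "l < u"
    then have "p l \<in> (\<Union>j\<in>{l..<u}. C j)"
      using C[of l] 0 by (intro UN_I[of l]) auto
    then show False using 0 by simp
  qed
  then show ?case by simp
next
  case (Suc d)
  show ?case
  proof (cases "l < u")
    case True
    have "conn E (\<Union>j\<in>{l..<u}. C j)"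
      using C path True Suc.prems(1) by (rule conn_UN_path)
    moreover have "(\<Union>j\<in>{l..<u}. C j) \<noteq> {}"
      using C[of l] True Suc.prems(1) by force
    ultimately obtain z where z: "z \<in> (\<Union>j\<in>{l..<u}. C j)" "elim_le E d ((\<Union>j\<in>{l..<u}. C j) - {z})"
      using Suc.prems(2) by auto
    then obtain m where m: "l \<le> m" "m < u" "z \<in> C m"
      by auto
    have notin: "z \<notin> C j" if "j < u" "j \<noteq> m" for j
      using disj[of j m] that m Suc.prems(1) by auto
    have "elim_le E d (\<Union>j\<in>{l..<m}. C j)"
      using z(2) by (rule elim_le_subset) (use m notin in fastforce)
    then have left: "(\<Sum>j=l..<m. 4 powr x j) \<le> 2 * 4 ^ d"
      using Suc.IH m Suc.prems(1) by simp
    have "elim_le E d (\<Union>j\<in>{Suc m..<u}. C j)"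
      using z(2) by (rule elim_le_subset) (use m notin in fastforce)
    then have right: "(\<Sum>j=Suc m..<u. 4 powr x j) \<le> 2 * 4 ^ d"
      using Suc.IH Suc.prems(1) by simp
    \<comment> \<open>The set that lost \<open>z\<close> is bounded without using the move, at the
      full \<open>Suc d\<close>.\<close>
    have "elim_le E (Suc d) (C m)"
      using Suc.prems(2) by (rule elim_le_subset) (use m in auto)
    then have "x m \<le> real (Suc d)"
      using x m Suc.prems(1) by (meson less_le_trans)
    then have "4 powr x m \<le> 4 powr real (Suc d)"
      by (intro powr_mono) auto
    then have mid: "4 powr x m \<le> 4 ^ Suc d"
      by (subst (asm) powr_realpow) auto
    have "(\<Sum>j=l..<u. 4 powr x j) =
        (\<Sum>j=l..<m. 4 powr x j) + 4 powr x m + (\<Sum>j=Suc m..<u. 4 powr x j)"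
      using m sum.atLeastLessThan_concat[of l m u "\<lambda>j. 4 powr x j"]
        sum.atLeast_Suc_lessThan[of m u "\<lambda>j. 4 powr x j"] by simp
    then show ?thesis
      using left right mid by simp
  qed simp
qed

text \<open>The expected number of elements of \<open>Y\<close> on a random root-to-leaf path starting at \<open>v\<close>.\<close>

fun hits :: "nat \<Rightarrow> nat set \<Rightarrow> nat \<Rightarrow> nat \<Rightarrow> real" where
  "hits N Y 0 v = indicator Y v"
| "hits N Y (Suc i) v = indicator Y v + (\<Sum>j<N. hits N Y i (child N i v j)) / real N"

text \<open>Used in two ways: a deleted child accounts for at least one hit, and a value below 1
  certifies that a vertex survives.\<close>

lemma hits_ge_indicator: "indicator Y v \<le> hits N Y i v"
proof (induction i arbitrary: v)
  case (Suc i)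
  have "0 \<le> hits N Y i w" for w
    by (rule order_trans[OF indicator_pos_le Suc])
  then show ?case by (simp add: sum_nonneg)
qed simp

text \<open>The bound is linear in \<open>hits\<close>, so it survives averaging over the children. A level at which no
  child is deleted gains \<open>log 4 (N / 2)\<close> from the path through the children. If some child is deleted,
  another child is hit less often than average, by enough to make up for the lost level; the edges
  from \<open>v\<close> to all of its children are what keeps \<open>C\<close> connected in this case.\<close>

lemma fan_treedepth_ge:
  assumes "2 \<le> N" "i \<le> N" "v \<notin> Y"
    and "\<And>x y. (x, y) \<in> fan_edges N i v \<Longrightarrow> {x, y} \<in> E"
  shows "\<exists>C. C \<subseteq> {v..<v + fan_size N i} - Y \<and> v \<in> C \<and> conn E C \<and>
    (\<forall>d. elim_le E d C \<longrightarrow> log 4 (N / 2) * (real i - 2 * real N * hits N Y i v) \<le> real d)"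
  using assms(2-4)
proof (induction i arbitrary: v)
  case 0
  then show ?case
    by (intro exI[of _ "{v}"]) (auto simp: conn_singleton)
next
  case (Suc i)
  define g where "g = log 4 (real N / 2)"
  have "g \<ge> 0" using \<open>2 \<le> N\<close> by (simp add: g_def)
  define h where "h = hits N Y (Suc i) v"
  define c where "c = child N i v"
  have sum: "(\<Sum>j<N. hits N Y i (c j)) = real N * h"
    using Suc.prems(2) \<open>2 \<le> N\<close> by (simp add: h_def c_def)
  have size: "c j + fan_size N i \<le> v + fan_size N (Suc i)" if "j < N" for j
    using child_block_end[OF that] by (simp add: c_def del: fan_size.simps)
  have cv: "v < c j" for j
    by (simp add: c_def child_gt)
  have IH: "\<exists>C. C \<subseteq> {c j..<c j + fan_size N i} - Y \<and> c j \<in> C \<and> conn E C \<and>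
      (\<forall>d. elim_le E d C \<longrightarrow> g * (real i - 2 * real N * hits N Y i (c j)) \<le> real d)"
    if "j < N" "c j \<notin> Y" for j
    unfolding g_def
  proof (rule Suc.IH)
    show "{x, y} \<in> E" if "(x, y) \<in> fan_edges N i (c j)" for x y
      using Suc.prems(3)[of x y] that \<open>j < N\<close> by (auto simp: c_def)
  qed (use that Suc.prems(1) in auto)
  have spoke: "{v, c j} \<in> E" if "j < N" for j
    using Suc.prems(3)[of v "c j"] that by (auto simp: c_def)
  have path: "{c j, c (Suc j)} \<in> E" if "Suc j < N" for j
    using Suc.prems(3)[of "c j" "c (Suc j)"] that by (auto simp: c_def)
  \<comment> \<open>In the first case the claimed bound is not positive and \<open>{v}\<close>
    suffices; otherwise the split is on whether some child is deleted.\<close>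
  consider (low) "real (Suc i) \<le> 2 * real N * h"
    | (hit) j where "2 * real N * h < real (Suc i)" "j < N" "c j \<in> Y"
    | (free) "\<And>j. j < N \<Longrightarrow> c j \<notin> Y"
    by (meson not_le)
  then show ?case
  proof cases
    case low
    then have "g * (real (Suc i) - 2 * real N * h) \<le> 0"
      using \<open>g \<ge> 0\<close> by (simp add: mult_nonneg_nonpos)
    then have "\<forall>d. g * (real (Suc i) - 2 * real N * h) \<le> real d"
      by (meson of_nat_0_le_iff order_trans)
    then show ?thesis
      using Suc.prems fan_size_pos[of N "Suc i"] unfolding g_def[symmetric] h_def[symmetric]
      by (intro exI[of _ "{v}"]) (auto simp: conn_singleton simp del: fan_size.simps)
  next
    case (hit k)
    have "2 * real N * h < real N"
      using hit(1) Suc.prems(1) by linarith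
    then have half: "h < 1 / 2"
      using \<open>2 \<le> N\<close> by (simp add: field_simps)
    \<comment> \<open>Otherwise child \<open>k\<close> with at least 1 and the other
      \<open>N - 1\<close> children with more than \<open>h - 1 / (2 * N)\<close> each would exceed
      the total \<open>N * h\<close>, because \<open>h < 1 / 2\<close>.\<close>
    have "\<exists>j<N. hits N Y i (c j) \<le> h - 1 / (2 * real N)"
    proof (rule ccontr)
      assume "\<not> (\<exists>j<N. hits N Y i (c j) \<le> h - 1 / (2 * real N))"
      then have "(\<Sum>j\<in>{..<N} - {k}. h - 1 / (2 * real N)) \<le> (\<Sum>j\<in>{..<N} - {k}. hits N Y i (c j))"
        by (intro sum_mono) (auto simp: not_le intro: less_imp_le)
      moreover have "1 \<le> hits N Y i (c k)"
        using hits_ge_indicator[of Y "c k" N i] hit(3) by simp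
      ultimately have "1 + (real N - 1) * (h - 1 / (2 * real N)) \<le> real N * h"
        using sum hit(2) \<open>2 \<le> N\<close> by (simp add: sum.remove[of "{..<N}" k] of_nat_diff)
      moreover have "(real N - 1) * (h - 1 / (2 * real N)) = real N * h - h - 1 / 2 + 1 / (2 * real N)"
        using \<open>2 \<le> N\<close> by (simp add: field_simps)
      moreover have "0 < 1 / (2 * real N)" using \<open>2 \<le> N\<close> by simp
      ultimately show False using half by linarith
    qed
    then obtain j where j: "j < N" "hits N Y i (c j) \<le> h - 1 / (2 * real N)"
      by blast
    have "0 < 1 / (2 * real N)" using \<open>2 \<le> N\<close> by simp
    then have "hits N Y i (c j) < 1" using j(2) half by linarith
    then have "c j \<notin> Y"
      using hits_ge_indicator[of Y "c j" N i] by (auto simp: indicator_def split: if_splits)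
    then obtain C where C: "C \<subseteq> {c j..<c j + fan_size N i} - Y" "c j \<in> C" "conn E C"
      "\<And>d. elim_le E d C \<Longrightarrow> g * (real i - 2 * real N * hits N Y i (c j)) \<le> real d"
      using IH[OF j(1)] by blast
    \<comment> \<open>Weighted by \<open>2 * N\<close>, the saving of \<open>1 / (2 * N)\<close> is
      exactly the one level lost by passing to a single child.\<close>
    have "2 * real N * hits N Y i (c j) \<le> 2 * real N * (h - 1 / (2 * real N))"
      using j(2) by (intro mult_left_mono) auto
    also have "\<dots> = 2 * real N * h - 1"
      using \<open>2 \<le> N\<close> by (simp add: field_simps)
    finally have "g * (real (Suc i) - 2 * real N * h) \<le> g * (real i - 2 * real N * hits N Y i (c j))"
      using \<open>g \<ge> 0\<close> by (intro mult_left_mono) auto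
    then have "g * (real (Suc i) - 2 * real N * h) \<le> real d" if "elim_le E d ({v} \<union> C)" for d
      using C(4)[of d] elim_le_subset[OF that, of C] by fastforce
    moreover have "conn E ({v} \<union> C)"
      using C spoke[OF j(1)] by (intro conn_Un[OF conn_singleton]) auto
    moreover have "{v} \<union> C \<subseteq> {v..<v + fan_size N (Suc i)} - Y"
      using C(1) size[OF j(1)] cv[of j] Suc.prems(2) fan_size_pos[of N "Suc i"]
      by (fastforce simp del: fan_size.simps)
    ultimately show ?thesis
      unfolding g_def[symmetric] h_def[symmetric]
      by (intro exI[of _ "{v} \<union> C"]) auto
  next
    case free
    define x where "x j = g * (real i - 2 * real N * hits N Y i (c j))" for j
    from IH free have "\<forall>j\<in>{..<N}. \<exists>C. C \<subseteq> {c j..<c j + fan_size N i} - Y \<and> c j \<in> C \<and> conn E C \<and>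
      (\<forall>d. elim_le E d C \<longrightarrow> x j \<le> real d)"
      by (simp add: x_def)
    then obtain C where C: "\<And>j. j < N \<Longrightarrow> C j \<subseteq> {c j..<c j + fan_size N i} - Y"
      "\<And>j. j < N \<Longrightarrow> conn E (C j) \<and> c j \<in> C j"
      "\<And>j d. j < N \<Longrightarrow> elim_le E d (C j) \<Longrightarrow> x j \<le> real d"
      by (metis lessThan_iff)
    define U where "U = (\<Union>j\<in>{0..<N}. C j)"
    have disj: "C j \<inter> C k = {}" if "j < N" "k < N" "j \<noteq> k" for j k
    proof -
      have "c j + fan_size N i \<le> c k \<or> c k + fan_size N i \<le> c j"
        using child_mono[of "Suc j" k N i v] child_mono[of "Suc k" j N i v] that(3)
        unfolding c_def child_Suc by linarith
      then show ?thesis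
        using C(1)[OF that(1)] C(1)[OF that(2)] by fastforce
    qed
    have bound: "g * (real (Suc i) - 2 * real N * h) \<le> real d" if d: "elim_le E d ({v} \<union> U)" for d
    proof -
      have "elim_le E d (\<Union>j\<in>{0..<N}. C j)"
        using d by (rule elim_le_subset) (auto simp: U_def)
      with C(2) path C(3) disj order_refl have "(\<Sum>j=0..<N. 4 powr x j) \<le> 2 * 4 ^ d"
        by (rule sum_powr_le_of_path)
      then have "real N * 4 powr ((\<Sum>j<N. x j) / real N) \<le> 2 * 4 ^ d"
        using sum_powr_ge[of N 4 x] \<open>2 \<le> N\<close> by (simp add: atLeast0LessThan)
      \<comment> \<open>The children's bounds average to the claimed one with \<open>i\<close> for
        \<open>Suc i\<close>; the missing \<open>g\<close> comes from the factor
        \<open>N / 2\<close>, where the 2 is that of \<open>2 * 4 ^ d\<close>.\<close>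
      moreover have "(\<Sum>j<N. x j) / real N = g * (real i - 2 * real N * h)"
      proof -
        have "(\<Sum>j<N. x j) = g * (real N * real i - 2 * real N * (real N * h))"
          unfolding x_def sum[symmetric]
          by (simp add: sum_subtractf flip: sum_distrib_left)
        then show ?thesis
          using \<open>2 \<le> N\<close> by (simp add: field_simps)
      qed
      moreover have "4 powr g = real N / 2"
        using \<open>2 \<le> N\<close> by (simp add: g_def)
      ultimately have "4 powr g * 4 powr (g * (real i - 2 * real N * h)) \<le> 4 ^ d"
        by (simp only:)
      then have "4 powr (g + g * (real i - 2 * real N * h)) \<le> 4 powr real d"
        by (simp add: powr_add powr_realpow)
      then have "g + g * (real i - 2 * real N * h) \<le> real d"
        by (subst (asm) powr_le_cancel_iff) auto
      then show ?thesis
        by (simp add: algebra_simps)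
    qed
    have "conn E U"
      unfolding U_def using C(2) path by (rule conn_UN_path) (use \<open>2 \<le> N\<close> in auto)
    then have "conn E ({v} \<union> U)"
      using C(2)[of 0] spoke[of 0] \<open>2 \<le> N\<close> unfolding U_def
      by (intro conn_Un[OF conn_singleton]) auto
    moreover have "{v} \<union> U \<subseteq> {v..<v + fan_size N (Suc i)} - Y"
    proof -
      have "C j \<subseteq> {v..<v + fan_size N (Suc i)} - Y" if "j < N" for j
        using C(1)[OF that] size[OF that] cv[of j] by (fastforce simp del: fan_size.simps)
      then have "U \<subseteq> {v..<v + fan_size N (Suc i)} - Y"
        unfolding U_def by (intro UN_least) simp
      then show ?thesis
        using Suc.prems(2) fan_size_pos[of N "Suc i"] by simp
    qed
    ultimately show ?thesis
      using bound unfolding g_def[symmetric] h_def[symmetric]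
      by (intro exI[of _ "{v} \<union> U"]) auto
  qed
qed

section \<open>Choosing a deletion set with few hits\<close>

lemma expectation_indicator_mem:
  "measure_pmf.expectation p (\<lambda>Y. indicator Y v :: real) = measure_pmf.prob p {Y. v \<in> Y}"
proof -
  have "(\<lambda>Y. indicator Y v :: real) = indicator {Y. v \<in> Y}"
    by (auto simp: indicator_def)
  then show ?thesis by simp
qed

text \<open>By linearity: a root-to-leaf path has one vertex on each of \<open>i + 1\<close> levels,
  and each is deleted with probability at most \<open>\<epsilon>\<close>.\<close>

lemma expectation_hits_le:
  assumes "finite (set_pmf p)" "thin \<epsilon> {..<s} p" "v + fan_size N i \<le> s" "N > 0"
  shows "measure_pmf.expectation p (\<lambda>Y. hits N Y i v) \<le> real (Suc i) * \<epsilon>"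
  using assms(3)
proof (induction i arbitrary: v)
  case 0
  then show ?case
    using assms(2) by (simp add: thin_def expectation_indicator_mem)
next
  case (Suc i)
  have le: "v < s" using Suc.prems by simp
  have int: "integrable (measure_pmf p) f" for f :: "nat set \<Rightarrow> real"
    using assms(1) by (rule integrable_measure_pmf_finite)
  have "measure_pmf.expectation p (\<lambda>Y. hits N Y (Suc i) v) =
      measure_pmf.prob p {Y. v \<in> Y} +
      (\<Sum>j<N. measure_pmf.expectation p (\<lambda>Y. hits N Y i (child N i v j))) / real N"
    by (simp add: int expectation_indicator_mem)
  also have "\<dots> \<le> \<epsilon> + (\<Sum>j<N. real (Suc i) * \<epsilon>) / real N"
  proof (intro add_mono divide_right_mono sum_mono)
    fix j assume "j \<in> {..<N}"
    then have "child N i v j + fan_size N i \<le> s"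
      using child_block_end[of j N i v] Suc.prems by simp
    then show "measure_pmf.expectation p (\<lambda>Y. hits N Y i (child N i v j)) \<le> real (Suc i) * \<epsilon>"
      by (rule Suc.IH)
  qed (use assms(2) le in \<open>auto simp: thin_def\<close>)
  also have "\<dots> = real (Suc (Suc i)) * \<epsilon>"
    using assms(4) by (simp add: field_simps)
  finally show ?case .
qed

lemma exists_le_expectation_pmf:
  fixes f :: "'a \<Rightarrow> real"
  assumes "finite (set_pmf p)"
  shows "\<exists>x\<in>set_pmf p. f x \<le> measure_pmf.expectation p f"
proof -
  define c where "c = Min (f ` set_pmf p)"
  have "c \<in> f ` set_pmf p"
    unfolding c_def using assms by (intro Min_in) (auto simp: set_pmf_not_empty)
  moreover have "c \<le> measure_pmf.expectation p f"
    using assms by (intro measure_pmf.integral_ge_const integrable_measure_pmf_finite)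
      (auto simp: AE_measure_pmf_iff c_def)
  ultimately show ?thesis by auto
qed

text \<open>With \<open>N + 1\<close> levels and \<open>4 * (N + 1) \<le> a\<close>, some outcome
  has at most 1/4 hits on average; weighted by \<open>2 * N\<close>, this costs at most half of the
  \<open>N\<close> levels.\<close>

lemma fragile_rate_ge:
  fixes r :: "nat \<Rightarrow> real"
  assumes fragile: "\<And>G :: nat graph. outerplanar G \<Longrightarrow>
      fractionally_fragile (\<lambda>H. real (treedepth H)) r G"
    and "2 \<le> N" "4 * (N + 1) \<le> a"
  shows "log 4 (real N / 2) * (real N / 2) \<le> r a"
proof -
  define s where "s = fan_size N N"
  define G :: "nat graph" where "G = \<lparr>verts = {..<s}, edges = (\<lambda>(x, y). {x, y}) ` fan_edges N N 0\<rparr>"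
  have "outerplanar G"
    unfolding G_def
  proof (rule outerplanar_noncrossing)
    show "x < y \<and> y < s" if "(x, y) \<in> fan_edges N N 0" for x y
      using fan_edges_bounds[OF that] by (simp add: s_def)
  qed (rule fan_edges_noncrossing)
  moreover have "a \<ge> 1" using assms by simp
  ultimately obtain p where
    p: "set_pmf p \<subseteq> {Y. Y \<subseteq> verts G \<and> real (treedepth (del_verts G Y)) \<le> r a}"
    "thin (1 / real a) (verts G) p"
    using fragile unfolding fractionally_fragile_def by blast
  have fin: "finite (set_pmf p)"
    by (rule finite_subset[of _ "Pow {..<s}"]) (use p(1) in \<open>auto simp: G_def\<close>)
  have "measure_pmf.expectation p (\<lambda>Y. hits N Y N 0) \<le> real (Suc N) * (1 / real a)"
    using p(2) assms(2) by (intro expectation_hits_le[OF fin, of _ s]) (auto simp: G_def s_def)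
  also have "\<dots> \<le> 1 / 4"
  proof -
    have "real (4 * (N + 1)) \<le> real a" using assms(3) by (rule of_nat_mono)
    then show ?thesis using \<open>a \<ge> 1\<close> by (simp add: field_simps)
  qed
  finally obtain Y where Y: "Y \<in> set_pmf p" "hits N Y N 0 \<le> 1 / 4"
    using exists_le_expectation_pmf[OF fin, of "\<lambda>Y. hits N Y N 0"] by force
  have "0 \<notin> Y"
    using hits_ge_indicator[of Y 0 N N] Y(2) by (auto simp: indicator_def split: if_splits)
  then obtain C where C: "C \<subseteq> {0..<0 + fan_size N N} - Y"
    "\<And>d. elim_le (edges G) d C \<Longrightarrow> log 4 (N / 2) * (real N - 2 * real N * hits N Y N 0) \<le> real d"
    using fan_treedepth_ge[OF assms(2) order_refl, of 0 Y "edges G"] by (fastforce simp: G_def)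
  have "elim_le (edges G) (treedepth (del_verts G Y)) (verts (del_verts G Y))"
  proof (rule elim_le_treedepth)
    have "e \<subseteq> {..<s} \<and> card e = 2" if "e \<in> edges G" for e
      using that fan_edges_bounds[of _ _ N N 0] by (fastforce simp: G_def s_def card_2_iff)
    then show "e \<subseteq> verts (del_verts G Y) \<and> card e = 2" if "e \<in> edges (del_verts G Y)" for e
      using that by (auto simp: del_verts_def G_def)
  qed (auto simp: del_verts_def G_def)
  then have "elim_le (edges G) (treedepth (del_verts G Y)) C"
    by (rule elim_le_subset) (use C(1) in \<open>auto simp: del_verts_def G_def s_def\<close>)
  then have "log 4 (N / 2) * (real N - 2 * real N * hits N Y N 0) \<le> real (treedepth (del_verts G Y))"
    by (rule C(2))
  also have "\<dots> \<le> r a"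
    using p(1) Y(1) by auto
  finally have "log 4 (N / 2) * (real N - 2 * real N * hits N Y N 0) \<le> r a" .
  moreover have "real N / 2 \<le> real N - 2 * real N * hits N Y N 0"
    using mult_left_mono[OF Y(2), of "2 * real N"] by simp
  then have "log 4 (N / 2) * (real N / 2) \<le> log 4 (N / 2) * (real N - 2 * real N * hits N Y N 0)"
    using assms(2) by (intro mult_left_mono) auto
  ultimately show ?thesis by linarith
qed

theorem theorem26:
  fixes r :: "nat \<Rightarrow> real"
  assumes "\<And>a. r a \<ge> 0"
    and "mono r"
    and "\<And>G :: nat graph. outerplanar G \<Longrightarrow>
           fractionally_fragile (\<lambda>H. real (treedepth H)) r G"
  shows "r \<in> \<Omega>(\<lambda>a. real a * ln (real a))"
proof (rule landau_omega.bigI)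
  \<comment> \<open>1/64 is 1/2 from the logarithm times 1/32 from
    \<open>N / 2 \<ge> a / 32\<close>; \<open>ln 4\<close> converts the base.\<close>
  show "1 / (64 * ln 4) > (0 :: real)" by simp
  show "eventually (\<lambda>a. norm (r a) \<ge> 1 / (64 * ln 4) * norm (real a * ln (real a))) at_top"
    \<comment> \<open>1024 is the square of 32: from \<open>a \<le> 16 * N\<close> it gives
      \<open>a \<le> (N / 2) ^ 2\<close>, hence half of \<open>ln a\<close> is at most
      \<open>ln (N / 2)\<close>.\<close>
    using eventually_ge_at_top[of 1024]
  proof eventually_elim
    case (elim a)
    define N where "N = a div 8"
    have N: "2 \<le> N" "4 * (N + 1) \<le> a" "a \<le> 16 * N"
      using elim by (auto simp: N_def)
    have "ln (real a) / 2 \<le> ln (real N / 2)"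
    proof -
      have "32 ^ 2 * real a \<le> real a * real a"
        using elim by (intro mult_right_mono) auto
      also have "\<dots> \<le> (16 * real N) * (16 * real N)"
        using N(3) by (intro mult_mono) auto
      finally have "real a \<le> (real N / 2)\<^sup>2"
        by (simp add: power2_eq_square)
      then have "ln (real a) \<le> ln ((real N / 2)\<^sup>2)"
        using elim N(1) by (subst ln_le_cancel_iff) auto
      also have "\<dots> = 2 * ln (real N / 2)"
        using N(1) by (subst ln_realpow) auto
      finally show ?thesis by simp
    qed
    moreover have "real a / 32 \<le> real N / 2"
      using N(3) by simp
    ultimately have "ln (real a) / 2 * (real a / 32) \<le> ln (real N / 2) * (real N / 2)"
      using elim by (intro mult_mono) auto
    then have "ln (real a) / 2 * (real a / 32) / ln 4 \<le> ln (real N / 2) * (real N / 2) / ln 4"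
      by (intro divide_right_mono) auto
    also have "\<dots> = log 4 (real N / 2) * (real N / 2)"
      by (simp add: log_def)
    also have "\<dots> \<le> r a"
      using fragile_rate_ge[OF assms(3) N(1,2)] by simp
    finally show ?case
      using elim assms(1)[of a] by (simp add: field_simps)
  qed
qed

end
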